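(* Let $X$ be a locally compact $\sigma$-compact metrizable space and let $G$ be a group of homeomorphisms of $X$ such that the orbit space $G\backslash X$ is a regular space. If $G$ is equiregular and nearly proper, then $G$ is singly properly isometrizable.
   Context: Let $X$ be a topological space and $G$ a group of homeomorphisms of $X$. $G\backslash X$ denotes the orbit space with the quotient topology. Locally compact: every point has an open neighborhood whose closure is compact. $\sigma$-compact: a countable union of compact subsets. Regular means: for every point $x$ and every open neighborhood $U$ of $x$ there is an open neighborhood $V$ of $x$ with $\mathrm{cl}(V)\subset U$ (no further separation axiom is included). $G$ is singly properly isometrizable if there is a metric $\rho: X\times X\to[0,\infty)$ that determines the given topology of $X$, is $G$-invariant (i.e. $\rho(g(x),g(y))=\rho(x,y)$ for all $x,y\in X$, $g\in G$), and is proper (i.e. the closure of $\{y\in X:\rho(x,y)<\epsilon\}$ is compact for all $x\in X$ and $\epsilon\in(0,\infty)$). $G$ is equiregular if for every $x\in X$ and every open neighborhood $U$ of $x$ in $X$ there is an open neighborhood $V$ of $x$ in $X$ such that $\mathrm{cl}(V)\subset U$ and every $y\in X$ has an open neighborhood $N_y$ with the property that for every $g\in G$, if $g(N_y)\cap\mathrm{cl}(V)\ne\emptyset$, then $g(N_y)\subset U$. $G$ is nearly proper if for all compact subsets $A$ and $B$ of $X$, $\mathrm{cl}\big(\bigcup\{g(A):g\in G\text{ and }g(A)\cap B\neq\emptyset\}\big)$ is compact. *)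

theory Defs
  imports "HOL-Analysis.Analysis" "HOL-Algebra.Bij"
begin

definition sigma_compact_space :: "'a topology \<Rightarrow> bool" where
  "sigma_compact_space X \<longleftrightarrow>
    (\<exists>\<K>. countable \<K> \<and> (\<forall>K\<in>\<K>. compactin X K) \<and> \<Union>\<K> = topspace X)"

text \<open>
  Elements of \<open>BijGroup S\<close> are extensional, i.e. they are \<open>undefined\<close> outside \<open>S\<close>; so a
  homeomorphism of the space is represented by exactly one HOL function. Inverses in the
  group are again homeomorphisms because \<open>G\<close> is closed under inverses.
\<close>

definition homeomorphism_group :: "'a topology \<Rightarrow> ('a \<Rightarrow> 'a) set \<Rightarrow> bool" where
  "homeomorphism_group X G \<longleftrightarrow>
    subgroup G (BijGroup (topspace X)) \<and> (\<forall>g\<in>G. homeomorphic_map X X g)"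

definition orbit_of :: "('a \<Rightarrow> 'a) set \<Rightarrow> 'a \<Rightarrow> 'a set" where
  "orbit_of G x = {g x |g. g \<in> G}"

definition orbit_space :: "'a topology \<Rightarrow> ('a \<Rightarrow> 'a) set \<Rightarrow> 'a set topology" where
  "orbit_space X G = topology (\<lambda>U. U \<subseteq> orbit_of G ` topspace X \<and>
     openin X {x \<in> topspace X. orbit_of G x \<in> U})"

lemma openin_orbit_space:
  "openin (orbit_space X G) U \<longleftrightarrow>
     U \<subseteq> orbit_of G ` topspace X \<and> openin X {x \<in> topspace X. orbit_of G x \<in> U}"
proof -
  have "istopology (\<lambda>U. U \<subseteq> orbit_of G ` topspace X \<and>
     openin X {x \<in> topspace X. orbit_of G x \<in> U})" (is "istopology ?L")
    unfolding istopology_def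
  proof (intro conjI allI impI)
    fix S T assume "?L S" "?L T"
    moreover have "{x \<in> topspace X. orbit_of G x \<in> S \<inter> T} =
        {x \<in> topspace X. orbit_of G x \<in> S} \<inter> {x \<in> topspace X. orbit_of G x \<in> T}" by auto
    ultimately show "S \<inter> T \<subseteq> orbit_of G ` topspace X"
      "openin X {x \<in> topspace X. orbit_of G x \<in> S \<inter> T}"
      by auto
  next
    fix \<K> assume K: "\<forall>K\<in>\<K>. ?L K"
    then show "\<Union>\<K> \<subseteq> orbit_of G ` topspace X" by blast
    have "{x \<in> topspace X. orbit_of G x \<in> \<Union>\<K>} =
        (\<Union>K\<in>\<K>. {x \<in> topspace X. orbit_of G x \<in> K})" by auto
    with K show "openin X {x \<in> topspace X. orbit_of G x \<in> \<Union>\<K>}" by auto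
  qed
  then show ?thesis by (simp add: orbit_space_def)
qed

lemma topspace_orbit_space: "topspace (orbit_space X G) = orbit_of G ` topspace X"
proof
  show "topspace (orbit_space X G) \<subseteq> orbit_of G ` topspace X"
    using openin_orbit_space openin_topspace by blast
  have "{x \<in> topspace X. orbit_of G x \<in> orbit_of G ` topspace X} = topspace X" by auto
  then show "orbit_of G ` topspace X \<subseteq> topspace (orbit_space X G)"
    by (intro openin_subset) (simp add: openin_orbit_space)
qed

lemma quotient_map_orbit_space: "quotient_map X (orbit_space X G) (orbit_of G)"
  by (auto simp: quotient_map_def topspace_orbit_space openin_orbit_space)

definition singly_properly_isometrizable :: "'a topology \<Rightarrow> ('a \<Rightarrow> 'a) set \<Rightarrow> bool" where
  "singly_properly_isometrizable X G \<longleftrightarrow>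
    (\<exists>\<rho>. Metric_space (topspace X) \<rho> \<and> Metric_space.mtopology (topspace X) \<rho> = X \<and>
      (\<forall>g\<in>G. \<forall>x\<in>topspace X. \<forall>y\<in>topspace X. \<rho> (g x) (g y) = \<rho> x y) \<and>
      (\<forall>x\<in>topspace X. \<forall>\<epsilon>>0. compactin X (X closure_of {y \<in> topspace X. \<rho> x y < \<epsilon>})))"

definition equiregular :: "'a topology \<Rightarrow> ('a \<Rightarrow> 'a) set \<Rightarrow> bool" where
  "equiregular X G \<longleftrightarrow>
    (\<forall>x\<in>topspace X. \<forall>U. openin X U \<and> x \<in> U \<longrightarrow>
      (\<exists>V. openin X V \<and> x \<in> V \<and> X closure_of V \<subseteq> U \<and>
        (\<forall>y\<in>topspace X. \<exists>N. openin X N \<and> y \<in> N \<and>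
          (\<forall>g\<in>G. g ` N \<inter> X closure_of V \<noteq> {} \<longrightarrow> g ` N \<subseteq> U))))"

definition nearly_proper :: "'a topology \<Rightarrow> ('a \<Rightarrow> 'a) set \<Rightarrow> bool" where
  "nearly_proper X G \<longleftrightarrow>
    (\<forall>A B. compactin X A \<and> compactin X B \<longrightarrow>
      compactin X (X closure_of (\<Union>{g ` A |g. g \<in> G \<and> g ` A \<inter> B \<noteq> {}})))"

text \<open>
  The library notions of regularity and local compactness agree with the formulations by
  closures of neighbourhoods: regularity always, local compactness in Hausdorff spaces.
\<close>

lemma regular_space_iff_closure_of:
  "regular_space X \<longleftrightarrow>
    (\<forall>x\<in>topspace X. \<forall>U. openin X U \<and> x \<in> U \<longrightarrow>
      (\<exists>V. openin X V \<and> x \<in> V \<and> X closure_of V \<subseteq> U))" (is "_ = ?R")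
proof
  assume L: "regular_space X"
  show ?R
  proof (intro ballI allI impI)
    fix x U assume x: "x \<in> topspace X" and U: "openin X U \<and> x \<in> U"
    then have "closedin X (topspace X - U)" "x \<in> topspace X - (topspace X - U)" by auto
    with L obtain V W where VW: "openin X V" "openin X W" "x \<in> V" "topspace X - U \<subseteq> W" "disjnt V W"
      unfolding regular_space_def by meson
    have "X closure_of V \<subseteq> topspace X - W"
      using VW by (intro closure_of_minimal) (auto simp: disjnt_iff dest: openin_subset)
    with VW show "\<exists>V. openin X V \<and> x \<in> V \<and> X closure_of V \<subseteq> U" by blast
  qed
next
  assume R: ?R
  show "regular_space X"
    unfolding regular_space_def
  proof (intro allI impI)
    fix C a assume "closedin X C \<and> a \<in> topspace X - C"
    then have C: "closedin X C" "a \<in> topspace X" "openin X (topspace X - C)" "a \<in> topspace X - C"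
      by auto
    with R obtain V where V: "openin X V" "a \<in> V" "X closure_of V \<subseteq> topspace X - C" by meson
    have "V \<subseteq> X closure_of V" using V by (simp add: closure_of_subset openin_subset)
    with V C show "\<exists>U V. openin X U \<and> openin X V \<and> a \<in> U \<and> C \<subseteq> V \<and> disjnt U V"
      by (intro exI[of _ V] exI[of _ "topspace X - X closure_of V"])
         (auto simp: disjnt_iff dest: closedin_subset)
  qed
qed

lemma locally_compact_space_iff_closure_of:
  assumes "Hausdorff_space X"
  shows "locally_compact_space X \<longleftrightarrow>
    (\<forall>x\<in>topspace X. \<exists>U. openin X U \<and> x \<in> U \<and> compactin X (X closure_of U))" (is "_ = ?R")
proof
  assume L: "locally_compact_space X"
  show ?R
  proof
    fix x assume "x \<in> topspace X"
    with L obtain U K where UK: "openin X U" "compactin X K" "x \<in> U" "U \<subseteq> K"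
      unfolding locally_compact_space_def by meson
    then have "X closure_of U \<subseteq> K"
      using assms by (simp add: closure_of_minimal compactin_imp_closedin)
    with UK show "\<exists>U. openin X U \<and> x \<in> U \<and> compactin X (X closure_of U)"
      using closed_compactin closedin_closure_of by metis
  qed
next
  assume ?R
  then show "locally_compact_space X"
    unfolding locally_compact_space_def by (meson closure_of_subset openin_subset)
qed

end

(*
  Starting from a metric that extends to the one-point compactification of X, the supremum over
  all translates by G is an invariant metric for the topology: near a compact set this is
  equicontinuity, which equiregularity provides, and far out all distances are small. Rescaling
  it by the radius of relatively compact balls gives an invariant metric J for which the relation
  J < 1 maps compact sets into compact sets. By near properness so does the relation "x and y lie
  in a common translate of the compact set K n". Charging n + 1 for a step of the latter kind and
  J for a J-small step, the infimum of the costs of chains is a proper invariant metric.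
*)

theory Submission
  imports Defs
begin

section \<open>Metrics for a given topology\<close>

text \<open>Equiregularity controls a translate of a neighbourhood only when the translate meets a
  given small set, so it yields uniform control over all of \<open>G\<close> only for translates
  that meet a compact set. For an arbitrary bounded metric, translates that run off to infinity may
  spoil the compatibility of the supremum; this forces the start from a metric that is small far
  out. The invariant metric obtained in this way may still have relatively compact balls only at
  radii that shrink from point to point. Small steps can be composed safely only if one radius
  serves everywhere, hence the rescaling. Small steps alone also cannot join all pairs, since
  \<open>X\<close> may be disconnected; the translates of the compact sets supply the missing links
  without losing invariance.\<close>

definition compatible_metric :: "'a topology \<Rightarrow> ('a \<Rightarrow> 'a \<Rightarrow> real) \<Rightarrow> bool" where
  "compatible_metric X d \<longleftrightarrow>
    Metric_space (topspace X) d \<and> Metric_space.mtopology (topspace X) d = X"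

text \<open>The locale demands nonnegativity and symmetry on the whole type, also off the carrier,
  where the formulas used below are uncontrolled. The value 0 there repairs this.\<close>

lemma Metric_space_restrict:
  assumes "\<And>x y. x \<in> M \<Longrightarrow> y \<in> M \<Longrightarrow> 0 \<le> f x y"
    and "\<And>x y. x \<in> M \<Longrightarrow> y \<in> M \<Longrightarrow> f x y = f y x"
    and "\<And>x y. x \<in> M \<Longrightarrow> y \<in> M \<Longrightarrow> f x y = 0 \<longleftrightarrow> x = y"
    and "\<And>x y z. x \<in> M \<Longrightarrow> y \<in> M \<Longrightarrow> z \<in> M \<Longrightarrow> f x z \<le> f x y + f y z"
  shows "Metric_space M (\<lambda>x y. if x \<in> M \<and> y \<in> M then f x y else 0)"
  by unfold_locales (use assms in auto)

text \<open>Equality of topologies is split into its two inclusions at a point because they have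
  different sources later: for the supremum metric the first comes from comparison with
  \<open>D\<close>, the second from equicontinuity.\<close>

lemma compatible_metric_iff:
  "compatible_metric X d \<longleftrightarrow> Metric_space (topspace X) d \<and>
    (\<forall>x\<in>topspace X. \<forall>U. openin X U \<and> x \<in> U \<longrightarrow> (\<exists>\<delta>>0. \<forall>y\<in>topspace X. d x y < \<delta> \<longrightarrow> y \<in> U)) \<and>
    (\<forall>x\<in>topspace X. \<forall>\<epsilon>>0. \<exists>N. openin X N \<and> x \<in> N \<and> (\<forall>y\<in>N. d x y < \<epsilon>))"
  (is "_ \<longleftrightarrow> ?M \<and> ?U \<and> ?N")
proof (intro iffI conjI)
  assume c: "compatible_metric X d"
  then show ?M by (simp add: compatible_metric_def)
  then interpret Metric_space "topspace X" d .
  have eq: "mtopology = X" using c by (simp add: compatible_metric_def)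
  show ?U
  proof (intro ballI allI impI)
    fix x U assume "x \<in> topspace X" and "openin X U \<and> x \<in> U"
    then obtain r where "r > 0" "mball x r \<subseteq> U"
      using openin_mtopology[of U] eq by auto
    with \<open>x \<in> topspace X\<close> show "\<exists>\<delta>>0. \<forall>y\<in>topspace X. d x y < \<delta> \<longrightarrow> y \<in> U"
      by (intro exI[of _ r]) (auto simp: subset_iff)
  qed
  show ?N
  proof (intro ballI allI impI)
    fix x \<epsilon> assume "x \<in> topspace X" and "(0::real) < \<epsilon>"
    then show "\<exists>N. openin X N \<and> x \<in> N \<and> (\<forall>y\<in>N. d x y < \<epsilon>)"
      using openin_mball[of x \<epsilon>] eq by (intro exI[of _ "mball x \<epsilon>"]) auto
  qed
next
  assume a: "?M \<and> ?U \<and> ?N"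
  then interpret Metric_space "topspace X" d by simp
  have "openin mtopology U \<longleftrightarrow> openin X U" for U
  proof
    assume U: "openin mtopology U"
    have "\<exists>N. openin X N \<and> x \<in> N \<and> N \<subseteq> U" if "x \<in> U" for x
    proof -
      have x: "x \<in> topspace X" using openin_subset[OF U] that by auto
      obtain r where "r > 0" "mball x r \<subseteq> U"
        using U \<open>x \<in> U\<close> unfolding openin_mtopology by blast
      moreover obtain N where "openin X N" "x \<in> N" "\<forall>y\<in>N. d x y < r"
        using a x \<open>r > 0\<close> by meson
      ultimately show ?thesis
        using x openin_subset[of X N] by (intro exI[of _ N]) (auto simp: subset_iff)
    qed
    then show "openin X U" using openin_subopen[of X U] by blast
  next
    assume U: "openin X U"
    have "\<exists>r>0. mball x r \<subseteq> U" if "x \<in> U" for x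
    proof -
      have "x \<in> topspace X" using openin_subset[OF U] that by blast
      then obtain r where "r > 0" "\<forall>y\<in>topspace X. d x y < r \<longrightarrow> y \<in> U"
        using a U \<open>x \<in> U\<close> by blast
      then show ?thesis by (intro exI[of _ r]) auto
    qed
    then show "openin mtopology U" using openin_subset[OF U] by (simp add: openin_mtopology)
  qed
  then show "compatible_metric X d"
    unfolding compatible_metric_def using Metric_space_axioms by (simp add: topology_eq)
qed

lemma compatible_metric_ball:
  assumes "compatible_metric X d" "x \<in> topspace X" "\<epsilon> > 0"
  shows "openin X {y \<in> topspace X. d x y < \<epsilon>}"
proof -
  interpret Metric_space "topspace X" d using assms by (simp add: compatible_metric_def)
  have "mball x \<epsilon> = {y \<in> topspace X. d x y < \<epsilon>}" using assms by auto
  then show ?thesis using openin_mball[of x \<epsilon>] assms(1) by (simp add: compatible_metric_def)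
qed

text \<open>The \<delta> may depend on \<open>x\<close>. This matters for the truncated and rescaled
  metrics, which need not be uniformly equivalent to the original one.\<close>

lemma compatible_metric_transfer:
  assumes d: "compatible_metric X d" and m: "Metric_space (topspace X) d'"
    and 1: "\<And>x \<epsilon>. x \<in> topspace X \<Longrightarrow> \<epsilon> > 0 \<Longrightarrow> \<exists>\<delta>>0. \<forall>y\<in>topspace X. d x y < \<delta> \<longrightarrow> d' x y < \<epsilon>"
    and 2: "\<And>x \<epsilon>. x \<in> topspace X \<Longrightarrow> \<epsilon> > 0 \<Longrightarrow> \<exists>\<delta>>0. \<forall>y\<in>topspace X. d' x y < \<delta> \<longrightarrow> d x y < \<epsilon>"
  shows "compatible_metric X d'"
  unfolding compatible_metric_iff
proof (intro conjI m ballI allI impI)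
  fix x U assume x: "x \<in> topspace X" and "openin X U \<and> x \<in> U"
  then obtain \<epsilon> where \<epsilon>: "\<epsilon> > 0" "\<forall>y\<in>topspace X. d x y < \<epsilon> \<longrightarrow> y \<in> U"
    using d unfolding compatible_metric_iff by meson
  with 2[OF x \<epsilon>(1)] show "\<exists>\<delta>>0. \<forall>y\<in>topspace X. d' x y < \<delta> \<longrightarrow> y \<in> U" by meson
next
  fix x \<epsilon> assume x: "x \<in> topspace X" and "(0::real) < \<epsilon>"
  then obtain \<delta> where \<delta>: "\<delta> > 0" "\<forall>y\<in>topspace X. d x y < \<delta> \<longrightarrow> d' x y < \<epsilon>" using 1 by meson
  obtain N where "openin X N" "x \<in> N" "\<forall>y\<in>N. d x y < \<delta>"
    using d x \<delta>(1) unfolding compatible_metric_iff by meson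
  with \<delta> openin_subset[of X N] show "\<exists>N. openin X N \<and> x \<in> N \<and> (\<forall>y\<in>N. d' x y < \<epsilon>)"
    by blast
qed

text \<open>Here \<open>a\<close>, \<open>b\<close>, \<open>c\<close> are sides of a triangle and
  \<open>p\<close>, \<open>q\<close>, \<open>r\<close> the distances of its corners from infinity.
  Each leg on the right is direct or passes through infinity. Two direct legs are compared with
  \<open>c\<close>, every other combination with \<open>p + r\<close>.\<close>

lemma min_triangle: fixes a b c p q r :: real
  assumes "c \<le> a + b" "p \<le> a + q" "r \<le> b + q" "0 \<le> q"
  shows "min c (p + r) \<le> min a (p + q) + min b (q + r)"
proof -
  have "min c (p + r) \<le> c" "min c (p + r) \<le> p + r" by simp_all
  moreover have "min a (p + q) = a \<or> min a (p + q) = p + q" "min b (q + r) = b \<or> min b (q + r) = q + r"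
    by (simp_all add: min_def)
  ultimately show ?thesis using assms by (elim disjE) linarith+
qed

section \<open>Sigma-compactness and the distance from infinity\<close>

lemma sigma_compact_space_sequence:
  assumes "sigma_compact_space X"
  obtains C :: "nat \<Rightarrow> 'a set" where "\<And>n. compactin X (C n)" "(\<Union>n. C n) = topspace X"
proof -
  obtain \<K> where K: "countable \<K>" "\<forall>K\<in>\<K>. compactin X K" "\<Union>\<K> = topspace X"
    using assms by (auto simp: sigma_compact_space_def)
  \<comment> \<open>\<open>from_nat_into\<close> enumerates nonempty families only; adding the empty
    set, which is compact, also covers the case of an empty family.\<close>
  have "range (from_nat_into (insert {} \<K>)) = insert {} \<K>"
    using K(1) by (intro range_from_nat_into) auto
  then show ?thesis
  proof (intro that[of "from_nat_into (insert {} \<K>)"])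
    show "compactin X (from_nat_into (insert {} \<K>) n)" for n
      using from_nat_into[of "insert {} \<K>" n] K(2) by auto
  qed (use K(3) in simp)
qed

text \<open>
  The metric is that of the one-point compactification: points far out are joined through
  infinity, at a distance \<open>\<kappa>\<close> from it.
\<close>

lemma metric_vanishing_at_infinity:
  assumes lc: "locally_compact_space X" and sc: "sigma_compact_space X" and mz: "metrizable_space X"
  obtains D where "compatible_metric X D" "\<And>x y. x \<in> topspace X \<Longrightarrow> y \<in> topspace X \<Longrightarrow> D x y \<le> 2"
    "\<And>\<epsilon>. \<epsilon> > 0 \<Longrightarrow> \<exists>L. compactin X L \<and>
       (\<forall>x\<in>topspace X - L. \<forall>y\<in>topspace X - L. D x y < \<epsilon>)"
proof -
  let ?M = "topspace X"
  obtain M m where "Metric_space M m" "X = Metric_space.mtopology M m"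
    using mz metrizable_space_def by blast
  then have m: "compatible_metric X m"
    by (simp add: compatible_metric_def Metric_space.topspace_mtopology)
  then interpret Metric_space ?M m by (simp add: compatible_metric_def)
  obtain C :: "nat \<Rightarrow> 'a set" where C: "\<And>n. compactin X (C n)" "(\<Union>n. C n) = ?M"
    using sigma_compact_space_sequence[OF sc] by blast
  have "\<exists>U L. openin X U \<and> compactin X L \<and> C n \<subseteq> U \<and> U \<subseteq> L" for n
    using locally_compact_space_compact_closed_compact[of X] metrizable_imp_Hausdorff_space[OF mz]
      lc C(1)[of n] by blast
  then obtain U L where UL: "\<And>n. openin X (U n)" "\<And>n. compactin X (L n)" "\<And>n. C n \<subseteq> U n"
    "\<And>n. U n \<subseteq> L n" by metis
  have cover: "\<exists>n. x \<in> U n" if "x \<in> ?M" for x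
    using that UL(3) unfolding C(2)[symmetric] by blast
  \<comment> \<open>A first guess for the distance from infinity: it tends to 0 outside compact sets
    but need not be continuous.\<close>
  define h :: "'a \<Rightarrow> real" where "h y = (1/2) ^ (LEAST n. y \<in> U n)" for y
  have h: "0 \<le> h y" "h y \<le> 1" for y by (auto simp: h_def power_le_one)
  have h_ge: "(1/2)^n \<le> h y" if "y \<in> U n" for y n
    unfolding h_def using that by (intro power_decreasing Least_le) auto
  have h_le: "h y \<le> (1/2)^n" if "y \<in> ?M" "\<forall>k<n. y \<notin> U k" for y n
  proof -
    obtain i where "y \<in> U i" using cover \<open>y \<in> ?M\<close> by blast
    then have "y \<in> U (LEAST n. y \<in> U n)" by (rule LeastI)
    then have "n \<le> (LEAST n. y \<in> U n)" using that(2) not_less by blast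
    then show ?thesis unfolding h_def by (intro power_decreasing) auto
  qed
  \<comment> \<open>The largest 1-Lipschitz function below \<open>h\<close>. The Lipschitz property
    is what the triangle inequality of \<open>D\<close> requires, and lying below \<open>h\<close>
    preserves the decay.\<close>
  define \<kappa> where "\<kappa> x = (INF y\<in>?M. m x y + h y)" for x
  have bdd: "bdd_below ((\<lambda>y. m x y + h y) ` ?M)" for x
    by (rule bdd_belowI2[of _ 0]) (simp add: h)
  have k_le: "\<kappa> x \<le> m x y + h y" if "y \<in> ?M" for x y
    unfolding \<kappa>_def by (rule cINF_lower[OF bdd that])
  have k_le_h: "\<kappa> x \<le> h x" if "x \<in> ?M" for x using k_le[OF that, of x] that by simp
  have k_lip: "\<kappa> x \<le> m x y + \<kappa> y" if "x \<in> ?M" "y \<in> ?M" for x y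
  proof -
    have "\<kappa> x - m x y \<le> \<kappa> y" unfolding \<kappa>_def[of y]
    proof (rule cINF_greatest)
      fix z assume "z \<in> ?M"
      then show "\<kappa> x - m x y \<le> m y z + h z"
        using k_le[of z x] triangle[of x y z] that by simp
    qed (use that in auto)
    then show ?thesis by simp
  qed
  have k_pos: "\<kappa> x > 0" if x: "x \<in> ?M" for x
  proof -
    obtain n where n: "x \<in> U n" using cover x by blast
    obtain \<delta> where \<delta>: "\<delta> > 0" "\<forall>y\<in>?M. m x y < \<delta> \<longrightarrow> y \<in> U n"
      using m x n UL(1) unfolding compatible_metric_iff by meson
    \<comment> \<open>Points within \<delta> of \<open>x\<close> lie in the open set
      \<open>U n\<close>, where \<open>h\<close> is at least \<open>(1/2)^n\<close>; all other
      points contribute at least \<delta> through \<open>m\<close>.\<close>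
    have "min \<delta> ((1/2)^n) \<le> \<kappa> x" unfolding \<kappa>_def
    proof (rule cINF_greatest)
      fix y assume y: "y \<in> ?M"
      show "min \<delta> ((1/2)^n) \<le> m x y + h y"
      proof (cases "m x y < \<delta>")
        case True
        then have "(1/2)^n \<le> h y" using h_ge \<delta> y by blast
        then show ?thesis using nonneg[of x y] by linarith
      qed (use h(1)[of y] in auto)
    qed (use x in auto)
    moreover have "min \<delta> ((1/2)^n) > 0" using \<delta> by simp
    ultimately show ?thesis by linarith
  qed
  define D where "D x y = (if x \<in> ?M \<and> y \<in> ?M then min (m x y) (\<kappa> x + \<kappa> y) else 0)" for x y
  have met: "Metric_space ?M D" unfolding D_def[abs_def]
  proof (rule Metric_space_restrict)
    fix x y assume xy: "x \<in> ?M" "y \<in> ?M"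
    show "0 \<le> min (m x y) (\<kappa> x + \<kappa> y)" using k_pos[OF xy(1)] k_pos[OF xy(2)] by simp
    show "min (m x y) (\<kappa> x + \<kappa> y) = min (m y x) (\<kappa> y + \<kappa> x)" by (simp add: commute add.commute)
    show "min (m x y) (\<kappa> x + \<kappa> y) = 0 \<longleftrightarrow> x = y"
      using k_pos[OF xy(1)] k_pos[OF xy(2)] zero[OF xy] by (auto simp: min_def)
  next
    fix x y z assume xyz: "x \<in> ?M" "y \<in> ?M" "z \<in> ?M"
    then show "min (m x z) (\<kappa> x + \<kappa> z) \<le> min (m x y) (\<kappa> x + \<kappa> y) + min (m y z) (\<kappa> y + \<kappa> z)"
      using triangle[OF xyz] k_lip[OF xyz(1,2)] k_lip[OF xyz(3,2)] k_pos[OF xyz(2)] commute[of z y]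
      by (intro min_triangle) simp_all
  qed
  have "compatible_metric X D"
  proof (rule compatible_metric_transfer[OF m met])
    fix x and \<epsilon> :: real assume x: "x \<in> ?M" and e: "\<epsilon> > 0"
    show "\<exists>\<delta>>0. \<forall>y\<in>?M. m x y < \<delta> \<longrightarrow> D x y < \<epsilon>"
      using e by (intro exI[of _ \<epsilon>]) (auto simp: D_def)
    show "\<exists>\<delta>>0. \<forall>y\<in>?M. D x y < \<delta> \<longrightarrow> m x y < \<epsilon>"
    \<comment> \<open>The route through infinity is longer than \<open>\<kappa> x\<close>, so below
      this bound \<open>D\<close> equals \<open>m\<close>.\<close>
    proof (intro exI[of _ "min \<epsilon> (\<kappa> x)"] conjI ballI impI)
      fix y assume "y \<in> ?M" "D x y < min \<epsilon> (\<kappa> x)"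
      then show "m x y < \<epsilon>" using x k_pos[of y] by (auto simp: D_def min_def split: if_splits)
    qed (use k_pos x e in simp)
  qed
  moreover have "D x y \<le> 2" if "x \<in> ?M" "y \<in> ?M" for x y
    using that k_le_h[of x] k_le_h[of y] h(2)[of x] h(2)[of y] by (auto simp: D_def)
  moreover have "\<exists>L. compactin X L \<and> (\<forall>x\<in>?M - L. \<forall>y\<in>?M - L. D x y < \<epsilon>)" if "\<epsilon> > 0" for \<epsilon>
  proof -
    obtain n where n: "(1/2)^n < \<epsilon>/2" using \<open>\<epsilon> > 0\<close> real_arch_pow_inv[of "\<epsilon>/2" "1/2"] by auto
    have "compactin X (\<Union>k<n. L k)" using UL(2) by (intro compactin_Union) auto
    moreover have \<kappa>_small: "\<kappa> x < \<epsilon>/2" if "x \<in> ?M - (\<Union>k<n. L k)" for x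
    proof -
      have "x \<in> ?M" "\<forall>k<n. x \<notin> U k" using that UL(4) by auto
      from h_le[OF this] k_le_h[OF this(1)] n show ?thesis by linarith
    qed
    then have "D x y < \<epsilon>" if "x \<in> ?M - (\<Union>k<n. L k)" "y \<in> ?M - (\<Union>k<n. L k)" for x y
    proof -
      have "\<kappa> x + \<kappa> y < \<epsilon>" using \<kappa>_small[OF that(1)] \<kappa>_small[OF that(2)] by linarith
      then show ?thesis using that by (simp add: D_def min_less_iff_disj)
    qed
    ultimately show ?thesis by blast
  qed
  ultimately show ?thesis by (rule that)
qed

section \<open>Invariant metrics\<close>

text \<open>The group laws are stated pointwise on \<open>S\<close> because products and inverses in
  \<open>BijGroup\<close> are restricted functions, of which only the values on \<open>S\<close>
  matter from here on.\<close>

definition acts_on :: "'a set \<Rightarrow> ('a \<Rightarrow> 'a) set \<Rightarrow> bool" where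
  "acts_on S G \<longleftrightarrow> (\<forall>g\<in>G. \<forall>x\<in>S. g x \<in> S) \<and> (\<exists>e\<in>G. \<forall>x\<in>S. e x = x) \<and>
    (\<forall>g\<in>G. \<forall>h\<in>G. \<exists>k\<in>G. \<forall>x\<in>S. k x = g (h x)) \<and>
    (\<forall>g\<in>G. \<exists>k\<in>G. \<forall>x\<in>S. k (g x) = x \<and> g (k x) = x)"

lemma acts_on_closed: "acts_on S G \<Longrightarrow> g \<in> G \<Longrightarrow> x \<in> S \<Longrightarrow> g x \<in> S"
  by (simp add: acts_on_def)

lemma acts_on_one: "acts_on S G \<Longrightarrow> \<exists>e\<in>G. \<forall>x\<in>S. e x = x"
  by (simp only: acts_on_def)

lemma acts_on_mult: "acts_on S G \<Longrightarrow> g \<in> G \<Longrightarrow> h \<in> G \<Longrightarrow> \<exists>k\<in>G. \<forall>x\<in>S. k x = g (h x)"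
  by (simp only: acts_on_def)

lemma acts_on_inverse: "acts_on S G \<Longrightarrow> g \<in> G \<Longrightarrow> \<exists>k\<in>G. \<forall>x\<in>S. k (g x) = x \<and> g (k x) = x"
  by (simp only: acts_on_def)

lemma homeomorphism_group_acts_on:
  assumes "homeomorphism_group X G"
  shows "acts_on (topspace X) G"
proof -
  let ?S = "topspace X"
  interpret S: subgroup G "BijGroup ?S" using assms by (simp add: homeomorphism_group_def)
  have Bij: "g \<in> Bij ?S" if "g \<in> G" for g
    using S.subset that by (auto simp: BijGroup_def)
  have maps: "g x \<in> ?S" if "g \<in> G" "x \<in> ?S" for g x
    using Bij_imp_funcset[OF Bij[OF that(1)]] that(2) by auto
  have one: "\<exists>e\<in>G. \<forall>x\<in>?S. e x = x"
    using S.one_closed by (intro bexI[of _ "\<one>\<^bsub>BijGroup ?S\<^esub>"]) (simp_all add: BijGroup_def)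
  have mult: "\<exists>k\<in>G. \<forall>x\<in>?S. k x = g (h x)" if "g \<in> G" "h \<in> G" for g h
    using S.m_closed[OF that] Bij[OF that(1)] Bij[OF that(2)]
    by (intro bexI[of _ "compose ?S g h"]) (simp_all add: BijGroup_def compose_eq)
  have inv: "\<exists>k\<in>G. \<forall>x\<in>?S. k (g x) = x \<and> g (k x) = x" if g: "g \<in> G" for g
  proof
    show "inv\<^bsub>BijGroup ?S\<^esub> g \<in> G" using S.m_inv_closed[OF g] .
    have b: "bij_betw g ?S ?S" using Bij[OF g] by (simp add: Bij_def)
    show "\<forall>x\<in>?S. (inv\<^bsub>BijGroup ?S\<^esub> g) (g x) = x \<and> g ((inv\<^bsub>BijGroup ?S\<^esub> g) x) = x"
      unfolding inv_BijGroup[OF Bij[OF g]]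
      using bij_betw_inv_into_left[OF b] bij_betw_inv_into_right[OF b] maps[OF g] by simp
  qed
  show ?thesis unfolding acts_on_def
    by (intro conjI ballI) (fact maps one mult inv)+
qed

section \<open>Suprema of a metric over all translates\<close>

definition invariant_metric :: "'a topology \<Rightarrow> ('a \<Rightarrow> 'a) set \<Rightarrow> ('a \<Rightarrow> 'a \<Rightarrow> real) \<Rightarrow> bool" where
  "invariant_metric X G d \<longleftrightarrow> compatible_metric X d \<and>
    (\<forall>g\<in>G. \<forall>x\<in>topspace X. \<forall>y\<in>topspace X. d (g x) (g y) = d x y)"

text \<open>
  Equiregularity makes \<open>G\<close> equicontinuous for \<open>D\<close> over a compact set, and outside a large
  compact set \<open>D\<close> is small anyway.
\<close>

lemma equiregular_equicontinuous:
  assumes er: "equiregular X G" and ac: "acts_on (topspace X) G" and D: "compatible_metric X D"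
    and L: "compactin X L" "\<And>y z. y \<in> topspace X - L \<Longrightarrow> z \<in> topspace X - L \<Longrightarrow> D y z < \<epsilon>"
    and x: "x \<in> topspace X" and e: "\<epsilon> > 0"
  obtains N where "openin X N" "x \<in> N" "\<And>g y. g \<in> G \<Longrightarrow> y \<in> N \<Longrightarrow> D (g x) (g y) < \<epsilon>"
proof -
  let ?M = "topspace X"
  interpret Metric_space ?M D using D by (simp add: compatible_metric_def)
  \<comment> \<open>For each such \<open>V\<close> one neighbourhood of \<open>x\<close> serves all
    \<open>g\<close> at once, provided that its translate meets \<open>V\<close>. These sets cover
    \<open>L\<close>, and a finite subcover allows the neighbourhoods to be intersected.\<close>
  define \<V> where "\<V> = {V. openin X V \<and> (\<exists>N. openin X N \<and> x \<in> N \<and>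
    (\<forall>g\<in>G. g ` N \<inter> V \<noteq> {} \<longrightarrow> (\<forall>y\<in>N. D (g x) (g y) < \<epsilon>)))}"
  have "\<exists>V\<in>\<V>. p \<in> V" if p: "p \<in> L" for p
  proof -
    let ?U = "{y \<in> ?M. D p y < \<epsilon>/2}"
    have pM: "p \<in> ?M" using compactin_subset_topspace[OF L(1)] p by auto
    have "openin X ?U \<and> p \<in> ?U" using compatible_metric_ball[OF D pM, of "\<epsilon>/2"] e pM by simp
    with er[unfolded equiregular_def, THEN bspec, OF pM, THEN spec, of ?U] obtain V where V: "openin X V" "p \<in> V"
      "\<forall>y\<in>?M. \<exists>N. openin X N \<and> y \<in> N \<and> (\<forall>g\<in>G. g ` N \<inter> X closure_of V \<noteq> {} \<longrightarrow> g ` N \<subseteq> ?U)"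
      by blast
    from bspec[OF V(3) x] obtain N where N: "openin X N" "x \<in> N"
      "\<forall>g\<in>G. g ` N \<inter> X closure_of V \<noteq> {} \<longrightarrow> g ` N \<subseteq> ?U" by blast
    have "D (g x) (g y) < \<epsilon>" if g: "g \<in> G" "g ` N \<inter> V \<noteq> {}" and y: "y \<in> N" for g y
    proof -
      have "g ` N \<inter> X closure_of V \<noteq> {}"
        using g(2) closure_of_subset[OF openin_subset[OF V(1)]] by blast
      then have "g x \<in> ?U" "g y \<in> ?U" using N g(1) y by blast+
      then show ?thesis using triangle[of "g x" p "g y"] pM commute[of "g x" p] by simp
    qed
    then have "V \<in> \<V>" using V(1) N(1,2) unfolding \<V>_def by blast
    then show ?thesis using V(2) by blast
  qed
  then have "L \<subseteq> \<Union>\<V>" by blast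
  moreover have "\<forall>V\<in>\<V>. openin X V" by (simp add: \<V>_def)
  ultimately obtain \<F> where F: "finite \<F>" "\<F> \<subseteq> \<V>" "L \<subseteq> \<Union>\<F>"
    using L(1) unfolding compactin_def by meson
  have "\<forall>V\<in>\<F>. \<exists>N. openin X N \<and> x \<in> N \<and>
    (\<forall>g\<in>G. g ` N \<inter> V \<noteq> {} \<longrightarrow> (\<forall>y\<in>N. D (g x) (g y) < \<epsilon>))"
    using F(2) by (auto simp: \<V>_def)
  then obtain N where N: "\<And>V. V \<in> \<F> \<Longrightarrow> openin X (N V)" "\<And>V. V \<in> \<F> \<Longrightarrow> x \<in> N V"
    "\<And>V g y. \<lbrakk>V \<in> \<F>; g \<in> G; g ` N V \<inter> V \<noteq> {}; y \<in> N V\<rbrakk> \<Longrightarrow> D (g x) (g y) < \<epsilon>"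
    by metis
  \<comment> \<open>The factor \<open>?M\<close> matters when \<F> is empty: the intersection over
    \<F> is then \<open>UNIV\<close>.\<close>
  let ?N = "?M \<inter> \<Inter>(N ` \<F>)"
  show ?thesis
  proof
    show "openin X ?N"
      using F(1) N(1) by (cases "\<F> = {}") (auto intro!: openin_Int openin_Inter)
    show "x \<in> ?N" using x N(2) by simp
    fix g y assume g: "g \<in> G" and y: "y \<in> ?N"
    have gM: "g x \<in> ?M" "g y \<in> ?M" using acts_on_closed[OF ac g] x y by auto
    show "D (g x) (g y) < \<epsilon>"
    proof (cases "g x \<in> L \<or> g y \<in> L")
      case True
      then obtain V where V: "V \<in> \<F>" "g x \<in> V \<or> g y \<in> V" using F(3) by blast
      then have "g ` N V \<inter> V \<noteq> {}" using N(2)[OF V(1)] y by auto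
      then show ?thesis using N(3)[OF V(1) g] y V(1) by blast
    qed (use L(2) gM in blast)
  qed
qed

text \<open>The bound makes the supremum finite, and precomposition with an element of
  \<open>G\<close> only permutes the translates. The identity of \<open>G\<close> gives
  \<open>D \<le> d\<close>, so \<open>d\<close> separates points and its small balls lie in given
  open sets; that its balls are neighbourhoods is equicontinuity.\<close>

lemma invariant_metric_exists:
  assumes er: "equiregular X G" and ac: "acts_on (topspace X) G" and D: "compatible_metric X D"
    and bound: "\<And>x y. x \<in> topspace X \<Longrightarrow> y \<in> topspace X \<Longrightarrow> D x y \<le> c"
    and vanish: "\<And>\<epsilon>. \<epsilon> > 0 \<Longrightarrow> \<exists>L. compactin X L \<and>
       (\<forall>x\<in>topspace X - L. \<forall>y\<in>topspace X - L. D x y < \<epsilon>)"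
  obtains d where "invariant_metric X G d"
proof -
  let ?M = "topspace X"
  interpret Metric_space ?M D using D by (simp add: compatible_metric_def)
  obtain e where e: "e \<in> G" "\<And>x. x \<in> ?M \<Longrightarrow> e x = x" using acts_on_one[OF ac] by blast
  have maps: "g x \<in> ?M" if "g \<in> G" "x \<in> ?M" for g x using acts_on_closed[OF ac that] .
  define d where "d x y = (SUP g\<in>G. D (g x) (g y))" for x y
  have d_ge: "D (g x) (g y) \<le> d x y" if "g \<in> G" "x \<in> ?M" "y \<in> ?M" for g x y
    unfolding d_def using that bound maps by (intro cSUP_upper bdd_aboveI2[of _ _ c]) auto
  have d_le: "d x y \<le> b" if "\<And>g. g \<in> G \<Longrightarrow> D (g x) (g y) \<le> b" for x y b
    unfolding d_def using that e(1) by (intro cSUP_least) auto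
  have D_le: "D x y \<le> d x y" if "x \<in> ?M" "y \<in> ?M" for x y
    using d_ge[OF e(1) that] e(2) that by simp
  have inv: "d (g x) (g y) = d x y" if g: "g \<in> G" and xy: "x \<in> ?M" "y \<in> ?M" for g x y
  proof (rule antisym)
    show "d (g x) (g y) \<le> d x y"
    proof (rule d_le)
      fix h assume "h \<in> G"
      then obtain k where "k \<in> G" "\<forall>x\<in>?M. k x = h (g x)" using acts_on_mult[OF ac _ g] by blast
      then show "D (h (g x)) (h (g y)) \<le> d x y" using d_ge[of k x y] xy by simp
    qed
    show "d x y \<le> d (g x) (g y)"
    proof (rule d_le)
      fix h assume h: "h \<in> G"
      obtain i where i: "i \<in> G" "\<forall>x\<in>?M. i (g x) = x" using acts_on_inverse[OF ac g] by blast
      obtain k where k: "k \<in> G" "\<forall>x\<in>?M. k x = h (i x)" using acts_on_mult[OF ac h i(1)] by blast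
      then show "D (h x) (h y) \<le> d (g x) (g y)"
        using d_ge[OF k(1) maps[OF g xy(1)] maps[OF g xy(2)]] k(2) i(2) maps[OF g] xy by simp
    qed
  qed
  define d' where "d' x y = (if x \<in> ?M \<and> y \<in> ?M then d x y else 0)" for x y
  have met: "Metric_space ?M d'" unfolding d'_def[abs_def]
  proof (rule Metric_space_restrict)
    fix x y assume xy: "x \<in> ?M" "y \<in> ?M"
    show "0 \<le> d x y" using D_le[OF xy] nonneg[of x y] by linarith
    show "d x y = d y x" unfolding d_def by (simp add: commute)
    show "d x y = 0 \<longleftrightarrow> x = y"
    proof
      assume "d x y = 0"
      then have "D x y = 0" using D_le[OF xy] nonneg[of x y] by linarith
      then show "x = y" using xy by simp
    next
      assume "x = y"
      then have "d x y \<le> 0" using maps xy by (intro d_le) simp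
      then show "d x y = 0" using D_le[OF xy] nonneg[of x y] by linarith
    qed
  next
    fix x y z assume xyz: "x \<in> ?M" "y \<in> ?M" "z \<in> ?M"
    show "d x z \<le> d x y + d y z"
    proof (rule d_le)
      fix g assume g: "g \<in> G"
      show "D (g x) (g z) \<le> d x y + d y z"
        using triangle[of "g x" "g y" "g z"] d_ge[OF g xyz(1,2)] d_ge[OF g xyz(2,3)] maps[OF g] xyz
        by simp
    qed
  qed
  have "compatible_metric X d'" unfolding compatible_metric_iff
  proof (intro conjI met ballI allI impI)
    fix x U assume x: "x \<in> ?M" and "openin X U \<and> x \<in> U"
    then obtain r where r: "r > 0" "\<forall>y\<in>?M. D x y < r \<longrightarrow> y \<in> U"
      using D unfolding compatible_metric_iff by meson
    show "\<exists>\<delta>>0. \<forall>y\<in>?M. d' x y < \<delta> \<longrightarrow> y \<in> U"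
    proof (intro exI[of _ r] conjI ballI impI r(1))
      fix y assume "y \<in> ?M" "d' x y < r"
      then show "y \<in> U" using r(2) D_le[OF x] x by (auto simp: d'_def intro: le_less_trans)
    qed
  next
    fix x and \<epsilon> :: real assume x: "x \<in> ?M" and "\<epsilon> > 0"
    \<comment> \<open>A supremum turns strict bounds into weak ones; halving \<epsilon> keeps the
      final inequality strict.\<close>
    then have e2: "\<epsilon>/2 > 0" by simp
    obtain L where L: "compactin X L" "\<forall>x\<in>?M - L. \<forall>y\<in>?M - L. D x y < \<epsilon>/2" using vanish[OF e2] by blast
    obtain N where N: "openin X N" "x \<in> N" "\<And>g y. g \<in> G \<Longrightarrow> y \<in> N \<Longrightarrow> D (g x) (g y) < \<epsilon>/2"
      using equiregular_equicontinuous[OF er ac D L(1) _ x e2] L(2) by blast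
    have "d' x y < \<epsilon>" if "y \<in> N" for y
    proof -
      have "d x y \<le> \<epsilon>/2" using N(3) that by (intro d_le) (simp add: less_imp_le)
      then show ?thesis using \<open>\<epsilon> > 0\<close> by (simp add: d'_def)
    qed
    then show "\<exists>N. openin X N \<and> x \<in> N \<and> (\<forall>y\<in>N. d' x y < \<epsilon>)" using N(1,2) by blast
  qed
  then have "invariant_metric X G d'" using inv maps by (simp add: invariant_metric_def d'_def)
  then show ?thesis by (rule that)
qed

section \<open>Making small balls relatively compact\<close>

text \<open>Relations are used instead of families of balls so that consecutive steps of a chain
  become relational composition, under which the property is stable.\<close>

definition compactly_bounded :: "'a topology \<Rightarrow> ('a \<times> 'a) set \<Rightarrow> bool" where
  "compactly_bounded X R \<longleftrightarrow> (\<forall>A. compactin X A \<longrightarrow> (\<exists>B. compactin X B \<and> R `` A \<subseteq> B))"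

lemma compactly_bounded_relcomp:
  assumes "compactly_bounded X R" "compactly_bounded X S"
  shows "compactly_bounded X (R O S)"
  unfolding compactly_bounded_def
proof (intro allI impI)
  fix A assume "compactin X A"
  then obtain B where B: "compactin X B" "R `` A \<subseteq> B"
    using assms(1) unfolding compactly_bounded_def by blast
  obtain C where "compactin X C" "S `` B \<subseteq> C"
    using assms(2) B(1) unfolding compactly_bounded_def by blast
  then show "\<exists>C. compactin X C \<and> (R O S) `` A \<subseteq> C"
    using B(2) by (intro exI[of _ C]) blast
qed

lemma compactly_bounded_Un:
  assumes "compactly_bounded X R" "compactly_bounded X S"
  shows "compactly_bounded X (R \<union> S)"
  unfolding compactly_bounded_def
proof (intro allI impI)
  fix A assume A: "compactin X A"
  obtain B where B: "compactin X B" "R `` A \<subseteq> B"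
    using assms(1) A unfolding compactly_bounded_def by blast
  obtain C where C: "compactin X C" "S `` A \<subseteq> C"
    using assms(2) A unfolding compactly_bounded_def by blast
  have "compactin X (B \<union> C)" using B(1) C(1) by (rule compactin_Un)
  then show "\<exists>B. compactin X B \<and> (R \<union> S) `` A \<subseteq> B"
    using B(2) C(2) by (intro exI[of _ "B \<union> C"]) blast
qed

lemma compactly_bounded_locally:
  assumes loc: "\<And>a. a \<in> topspace X \<Longrightarrow>
    \<exists>V B. openin X V \<and> a \<in> V \<and> compactin X B \<and> R `` V \<subseteq> B"
  shows "compactly_bounded X R"
  unfolding compactly_bounded_def
proof (intro allI impI)
  fix A assume A: "compactin X A"
  define \<V> where "\<V> = {V. openin X V \<and> (\<exists>B. compactin X B \<and> R `` V \<subseteq> B)}"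
  have "A \<subseteq> \<Union>\<V>"
  proof
    fix a assume "a \<in> A"
    then have "a \<in> topspace X" using compactin_subset_topspace[OF A] by auto
    from loc[OF this] show "a \<in> \<Union>\<V>" by (auto simp: \<V>_def)
  qed
  moreover have "\<forall>V\<in>\<V>. openin X V" by (simp add: \<V>_def)
  ultimately obtain \<F> where F: "finite \<F>" "\<F> \<subseteq> \<V>" "A \<subseteq> \<Union>\<F>"
    using A unfolding compactin_def by meson
  have "\<forall>V\<in>\<F>. \<exists>B. compactin X B \<and> R `` V \<subseteq> B" using F(2) by (auto simp: \<V>_def)
  from bchoice[OF this] obtain B where B: "\<forall>V\<in>\<F>. compactin X (B V) \<and> R `` V \<subseteq> B V" by blast
  have "compactin X (\<Union>(B ` \<F>))" using F(1) B by (intro compactin_Union) auto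
  moreover have "R `` A \<subseteq> \<Union>(B ` \<F>)"
  proof
    fix y assume "y \<in> R `` A"
    then obtain a V where "(a, y) \<in> R" "a \<in> V" "V \<in> \<F>" using F(3) by blast
    then show "y \<in> \<Union>(B ` \<F>)" using B by blast
  qed
  ultimately show "\<exists>B. compactin X B \<and> R `` A \<subseteq> B" by blast
qed

text \<open>Read \<open>a\<close>, \<open>b\<close>, \<open>c\<close> as the values of a Lipschitz
  function at three points and \<open>p\<close>, \<open>q\<close>, \<open>s\<close> as distances.
  Passing from \<open>q / a\<close> to \<open>q / b\<close> costs the factor \<open>b / a\<close>,
  which the Lipschitz bound keeps below \<open>1 + p / a\<close>. Hence these expressions are
  submultiplicative and their logarithms satisfy the triangle inequality. If
  \<open>b \<le> a\<close>, the common denominator \<open>b\<close> suffices.\<close>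

lemma distance_ratio_triangle_aux:
  fixes a b c p q s :: real
  assumes pos: "a > 0" "b > 0" "c > 0" "p \<ge> 0" "q \<ge> 0"
    and tri: "s \<le> p + q" and lip: "b \<le> a + p" and "a \<le> c"
  shows "1 + s / min a c \<le> (1 + p / min a b) * (1 + q / min b c)"
proof (cases "b \<le> a")
  case True
  have "s / a \<le> (p + q) / a" using tri pos by (simp add: divide_right_mono)
  also have "\<dots> \<le> (p + q) / b" using True pos by (intro divide_left_mono) auto
  finally have "1 + s / a \<le> 1 + p / b + q / b" by (simp add: add_divide_distrib)
  also have "\<dots> \<le> (1 + p / b) * (1 + q / b)" using pos by (simp add: algebra_simps)
  finally show ?thesis using True \<open>a \<le> c\<close> by (simp add: min_absorb1 min_absorb2)
next
  case False
  have "q / a = (b / a) * (q / b)" using pos by simp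
  also have "\<dots> \<le> (1 + p / a) * (q / b)"
    using pos lip by (intro mult_right_mono) (simp_all add: field_simps)
  finally have "(p + q) / a \<le> p / a + (1 + p / a) * (q / b)" by (simp add: add_divide_distrib)
  moreover have "s / a \<le> (p + q) / a" using tri pos by (simp add: divide_right_mono)
  ultimately have "1 + s / a \<le> (1 + p / a) * (1 + q / b)" by (simp add: distrib_left)
  also have "\<dots> \<le> (1 + p / a) * (1 + q / min b c)"
    using pos by (intro mult_left_mono add_left_mono divide_left_mono) auto
  finally show ?thesis using False \<open>a \<le> c\<close> by (simp add: min_def)
qed

text \<open>Reversing the path exchanges \<open>a\<close> with \<open>c\<close> and \<open>p\<close>
  with \<open>q\<close>, so a Lipschitz bound is assumed from either end.\<close>

lemma distance_ratio_triangle: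
  fixes a b c p q s :: real
  assumes "a > 0" "b > 0" "c > 0" "p \<ge> 0" "q \<ge> 0"
    and "s \<le> p + q" "b \<le> a + p" "b \<le> c + q"
  shows "1 + s / min a c \<le> (1 + p / min a b) * (1 + q / min b c)"
proof (cases "a \<le> c")
  case True
  then show ?thesis using assms by (intro distance_ratio_triangle_aux) auto
next
  case False
  then have "1 + s / min c a \<le> (1 + q / min c b) * (1 + p / min b a)"
    using assms by (intro distance_ratio_triangle_aux) auto
  then show ?thesis by (simp add: min.commute mult.commute)
qed

text \<open>
  The distance ratio metric of a positive 1-Lipschitz function \<open>r\<close>; the base of the logarithm
  makes its unit ball at \<open>x\<close> lie in the ball of radius \<open>r x / 4\<close>.
\<close>

lemma distance_ratio_metric:
  assumes d: "invariant_metric X G d" and ac: "acts_on (topspace X) G"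
    and pos: "\<And>x. x \<in> topspace X \<Longrightarrow> r x > 0"
    and lip: "\<And>x y. x \<in> topspace X \<Longrightarrow> y \<in> topspace X \<Longrightarrow> r x \<le> r y + d x y"
    and inv: "\<forall>g\<in>G. \<forall>x\<in>topspace X. r (g x) = r x"
  obtains J where "invariant_metric X G J"
    "\<And>x y. x \<in> topspace X \<Longrightarrow> y \<in> topspace X \<Longrightarrow> J x y < 1 \<longleftrightarrow> d x y < min (r x) (r y) / 4"
proof -
  let ?M = "topspace X"
  have dc: "compatible_metric X d" using d by (simp add: invariant_metric_def)
  then interpret Metric_space ?M d by (simp add: compatible_metric_def)
  define j where "j x y = 1 + d x y / min (r x) (r y)" for x y
  have min_pos: "min (r x) (r y) > 0" if "x \<in> ?M" "y \<in> ?M" for x y using pos that by simp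
  have j_ge: "j x y \<ge> 1" if "x \<in> ?M" "y \<in> ?M" for x y
    using min_pos[OF that] by (simp add: j_def)
  have j_less: "j x y < 1 + c \<longleftrightarrow> d x y < c * min (r x) (r y)" if "x \<in> ?M" "y \<in> ?M" for x y c
    using min_pos[OF that] by (simp add: j_def pos_divide_less_eq del: min_less_iff_conj)
  define J where "J x y = (if x \<in> ?M \<and> y \<in> ?M then log (5/4) (j x y) else 0)" for x y
  have met: "Metric_space ?M J" unfolding J_def[abs_def]
  proof (rule Metric_space_restrict)
    fix x y assume xy: "x \<in> ?M" "y \<in> ?M"
    have j1: "j x y \<ge> 1" by (rule j_ge[OF xy])
    show "0 \<le> log (5/4) (j x y)" using j1 by simp
    show "log (5/4) (j x y) = log (5/4) (j y x)" by (simp add: j_def commute min.commute)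
    have "0 < log (5/4) (j x y)" if "j x y \<noteq> 1" using j1 that by simp
    then have "log (5/4) (j x y) = 0 \<longleftrightarrow> j x y = 1" by force
    also have "\<dots> \<longleftrightarrow> d x y = 0"
      using min_pos[OF xy] by (simp add: j_def del: min_less_iff_conj)
    finally show "log (5/4) (j x y) = 0 \<longleftrightarrow> x = y" using xy by simp
  next
    fix x y z assume xyz: "x \<in> ?M" "y \<in> ?M" "z \<in> ?M"
    have "j x z \<le> j x y * j y z"
      unfolding j_def
      using pos[OF xyz(1)] pos[OF xyz(2)] pos[OF xyz(3)] triangle[OF xyz] lip[OF xyz(2,1)]
        lip[OF xyz(2,3)] commute[of y x]
      by (intro distance_ratio_triangle) auto
    then have "log (5/4) (j x z) \<le> log (5/4) (j x y * j y z)"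
      using j_ge[OF xyz(1,3)] by (intro log_mono) auto
    also have "\<dots> = log (5/4) (j x y) + log (5/4) (j y z)"
      using j_ge[OF xyz(1,2)] j_ge[OF xyz(2,3)] by (intro log_mult_pos) auto
    finally show "log (5/4) (j x z) \<le> log (5/4) (j x y) + log (5/4) (j y z)" .
  qed
  have "compatible_metric X J"
  proof (rule compatible_metric_transfer[OF dc met])
    fix x and \<epsilon> :: real assume x: "x \<in> ?M" and e: "\<epsilon> > 0"
    note rx = pos[OF x]
    \<comment> \<open>Chosen so that \<open>J x y < \<epsilon>\<close> means
      \<open>d x y < c * min (r x) (r y)\<close>.\<close>
    define c where "c = (5/4) powr \<epsilon> - 1"
    have c: "c > 0" using e by (simp add: c_def)
    show "\<exists>\<delta>>0. \<forall>y\<in>?M. d x y < \<delta> \<longrightarrow> J x y < \<epsilon>"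
    \<comment> \<open>Within distance \<open>r x / 2\<close> of \<open>x\<close> the Lipschitz bound
      keeps \<open>r y\<close> above \<open>r x / 2\<close>, which gives a lower bound for the
      minimum that does not depend on \<open>y\<close>.\<close>
    proof (intro exI[of _ "min (r x / 2) (c * (r x / 2))"] conjI ballI impI)
      fix y assume y: "y \<in> ?M" and "d x y < min (r x / 2) (c * (r x / 2))"
      then have d: "d x y < r x / 2" "d x y < c * (r x / 2)" by auto
      have "r x / 2 \<le> min (r x) (r y)" using lip[OF x y] d(1) rx by simp
      then have "c * (r x / 2) \<le> c * min (r x) (r y)" using c by (intro mult_left_mono) auto
      then have "j x y < (5/4) powr \<epsilon>" using j_less[OF x y, of c] d(2) by (simp add: c_def)
      then show "J x y < \<epsilon>" using j_ge[OF x y] x y by (simp add: J_def log_less_iff)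
    qed (use rx c in simp)
    show "\<exists>\<delta>>0. \<forall>y\<in>?M. J x y < \<delta> \<longrightarrow> d x y < \<epsilon>"
    proof (intro exI[of _ "log (5/4) (1 + \<epsilon> / r x)"] conjI ballI impI)
      fix y assume y: "y \<in> ?M" and "J x y < log (5/4) (1 + \<epsilon> / r x)"
      moreover have "1 + \<epsilon> / r x > 0" using e rx by (simp add: add_pos_pos)
      ultimately have "j x y < 1 + \<epsilon> / r x"
        using j_ge[OF x y] x y by (simp add: J_def)
      then have "d x y < \<epsilon> / r x * min (r x) (r y)" using j_less[OF x y] by blast
      also have "\<dots> \<le> \<epsilon> / r x * r x" using e rx by (intro mult_left_mono) auto
      finally show "d x y < \<epsilon>" using rx by simp
    qed (use rx e in \<open>simp add: add_pos_pos\<close>)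
  qed
  moreover have "J (g x) (g y) = J x y" if "g \<in> G" "x \<in> ?M" "y \<in> ?M" for g x y
    using that d inv acts_on_closed[OF ac that(1)] by (simp add: J_def j_def invariant_metric_def)
  moreover have "J x y < 1 \<longleftrightarrow> d x y < min (r x) (r y) / 4" if xy: "x \<in> ?M" "y \<in> ?M" for x y
    using j_ge[OF xy] j_less[OF xy, of "1/4"] xy by (simp add: J_def del: min_less_iff_conj)
  ultimately show ?thesis by (intro that[of J]) (auto simp: invariant_metric_def)
qed

text \<open>The radius \<open>r\<close> of relatively compact balls is 1-Lipschitz because the ball
  of radius \<open>s - d x y\<close> at \<open>y\<close> lies in the ball of radius \<open>s\<close>
  at \<open>x\<close>. It is invariant because elements of \<open>G\<close> are isometries of
  \<open>d\<close> and carry compact sets to compact sets.\<close>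

lemma invariant_metric_compactly_bounded:
  assumes d: "invariant_metric X G d" and G: "homeomorphism_group X G"
    and lc: "locally_compact_space X"
  obtains J where "invariant_metric X G J"
    "compactly_bounded X {(x, y). x \<in> topspace X \<and> y \<in> topspace X \<and> J x y < 1}"
proof -
  let ?M = "topspace X"
  have ac: "acts_on ?M G" by (rule homeomorphism_group_acts_on[OF G])
  have dc: "compatible_metric X d" using d by (simp add: invariant_metric_def)
  then interpret Metric_space ?M d by (simp add: compatible_metric_def)
  \<comment> \<open>The cap 1 keeps the supremum finite even if all balls are relatively compact;
    radius 0 always belongs to \<open>P x\<close>, with the empty set as witness.\<close>
  define P where "P x = {s. 0 \<le> s \<and> s \<le> 1 \<and> (\<exists>B. compactin X B \<and> (\<forall>y\<in>?M. d x y < s \<longrightarrow> y \<in> B))}" for x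
  define r where "r x = Sup (P x)" for x
  have bdd: "bdd_above (P x)" for x by (rule bdd_aboveI[of _ 1]) (simp add: P_def)
  have P0: "0 \<in> P x" for x using leD[OF nonneg] by (auto simp: P_def intro!: exI[of _ "{}"])
  have r_ge: "s \<le> r x" if "s \<in> P x" for s x unfolding r_def by (rule cSup_upper[OF that bdd])
  have r_le: "r x \<le> b" if "\<And>s. s \<in> P x \<Longrightarrow> s \<le> b" for x b
    unfolding r_def using that P0 by (intro cSup_least) auto
  have pos: "r x > 0" if x: "x \<in> ?M" for x
  proof -
    obtain U K where U: "openin X U" "compactin X K" "x \<in> U" "U \<subseteq> K"
      using lc x unfolding locally_compact_space_def by meson
    then obtain \<delta> where \<delta>: "\<delta> > 0" "\<forall>y\<in>?M. d x y < \<delta> \<longrightarrow> y \<in> U"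
      using dc x unfolding compatible_metric_iff by meson
    then have "min \<delta> 1 \<in> P x" using U(2,4) by (auto simp: P_def)
    from r_ge[OF this] \<delta>(1) show ?thesis by linarith
  qed
  have lip: "r x \<le> r y + d x y" if xy: "x \<in> ?M" "y \<in> ?M" for x y
  proof (rule r_le)
    fix s assume s: "s \<in> P x"
    show "s \<le> r y + d x y"
    proof (cases "s \<le> d x y")
      case False
      obtain B where B: "compactin X B" "\<forall>z\<in>?M. d x z < s \<longrightarrow> z \<in> B" using s by (auto simp: P_def)
      have "z \<in> B" if "z \<in> ?M" "d y z < s - d x y" for z
        using B(2) that triangle[of x y z] xy by force
      then have "s - d x y \<in> P y"
        using False s B(1) nonneg[of x y] unfolding P_def by (auto simp del: nonneg)
      from r_ge[OF this] show ?thesis by simp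
    qed (use pos[OF xy(2)] in simp)
  qed
  have P_sub: "P x \<subseteq> P (g x)" if g: "g \<in> G" and x: "x \<in> ?M" for g x
  proof
    fix s assume s: "s \<in> P x"
    then obtain B where B: "compactin X B" "\<forall>z\<in>?M. d x z < s \<longrightarrow> z \<in> B" by (auto simp: P_def)
    have "continuous_map X X g"
      using G g by (auto simp: homeomorphism_group_def homeomorphic_imp_continuous_map)
    then have "compactin X (g ` B)" by (rule image_compactin[OF B(1)])
    moreover have "z \<in> g ` B" if z: "z \<in> ?M" "d (g x) z < s" for z
    proof -
      obtain k where k: "k \<in> G" "\<forall>x\<in>?M. k (g x) = x \<and> g (k x) = x"
        using acts_on_inverse[OF ac g] by blast
      have kz: "k z \<in> ?M" by (rule acts_on_closed[OF ac k(1) z(1)])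
      have "d x (k z) = d (g x) (g (k z))" using d g x kz by (simp add: invariant_metric_def)
      then have "k z \<in> B" using B(2) kz k(2) z by simp
      moreover have "z = g (k z)" using k(2) z(1) by simp
      ultimately show ?thesis by (rule rev_image_eqI)
    qed
    ultimately show "s \<in> P (g x)" using s unfolding P_def by blast
  qed
  have inv: "\<forall>g\<in>G. \<forall>x\<in>?M. r (g x) = r x"
  proof (intro ballI)
    fix g x assume g: "g \<in> G" and x: "x \<in> ?M"
    obtain k where k: "k \<in> G" "\<forall>x\<in>?M. k (g x) = x \<and> g (k x) = x"
      using acts_on_inverse[OF ac g] by blast
    have "P (g x) \<subseteq> P x" using P_sub[OF k(1) acts_on_closed[OF ac g x]] k(2) x by simp
    then show "r (g x) = r x" using P_sub[OF g x] by (simp add: r_def)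
  qed
  obtain J where J: "invariant_metric X G J"
    "\<And>x y. x \<in> ?M \<Longrightarrow> y \<in> ?M \<Longrightarrow> J x y < 1 \<longleftrightarrow> d x y < min (r x) (r y) / 4"
    using distance_ratio_metric[OF d ac pos lip inv] by blast
  have "compactly_bounded X {(x, y). x \<in> ?M \<and> y \<in> ?M \<and> J x y < 1}" (is "compactly_bounded X ?R")
  proof (rule compactly_bounded_locally)
    fix a assume a: "a \<in> ?M"
    let ?V = "{y \<in> ?M. d a y < r a / 4}"
    have ra: "r a > 0" by (rule pos[OF a])
    \<comment> \<open>If \<open>y\<close> is in \<open>?V\<close>, then
      \<open>r y < 5/4 * r a\<close>, so a further step with \<open>J < 1\<close> is shorter than
      \<open>5/16 * r a\<close>. Together with the first \<open>1/4 * r a\<close> this stays below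
      \<open>9/16 * r a\<close>, which leaves room for some \<open>s\<close> in \<open>P a\<close>
      below the supremum.\<close>
    then have "9 / 16 * r a < Sup (P a)" unfolding r_def[symmetric] by simp
    then obtain s where s: "s \<in> P a" "9 / 16 * r a < s"
      using less_cSupD[of "P a" "9 / 16 * r a"] P0[of a] by blast
    obtain B where B: "compactin X B" "\<forall>z\<in>?M. d a z < s \<longrightarrow> z \<in> B" using s(1) by (auto simp: P_def)
    have "z \<in> B" if y: "y \<in> ?V" and z: "(y, z) \<in> ?R" for y z
    proof -
      have yz: "y \<in> ?M" "z \<in> ?M" "d a y < r a / 4" "d y z < min (r y) (r z) / 4"
        using y z J(2)[of y z] by auto
      have "d a z < s"
        using lip[OF yz(1) a] commute[of y a] triangle[OF a yz(1,2)] yz(3,4) s(2) by linarith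
      then show ?thesis using B(2) yz(2) by blast
    qed
    then have "?R `` ?V \<subseteq> B" by blast
    moreover have "openin X ?V" "a \<in> ?V"
      using compatible_metric_ball[OF dc a, of "r a / 4"] ra a by auto
    ultimately show "\<exists>V B. openin X V \<and> a \<in> V \<and> compactin X B \<and> ?R `` V \<subseteq> B"
      using B(1) by blast
  qed
  with J(1) show ?thesis by (rule that)
qed

section \<open>Proper metrics from chains\<close>

text \<open>The cost of a step is an argument of a relation and not a function value, since two
  points may be joined by steps of several costs or by none.\<close>

inductive chain_cost :: "('a \<Rightarrow> 'a \<Rightarrow> real \<Rightarrow> bool) \<Rightarrow> 'a \<Rightarrow> 'a \<Rightarrow> real \<Rightarrow> bool"
  for S where
  refl: "chain_cost S x x 0"
| step: "chain_cost S x y t \<Longrightarrow> S y z s \<Longrightarrow> chain_cost S x z (t + s)"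

lemma chain_cost_single: "S x y s \<Longrightarrow> chain_cost S x y s"
  using chain_cost.step[OF chain_cost.refl, of S x y s] by simp

lemma chain_cost_trans:
  assumes "chain_cost S y z s" "chain_cost S x y t"
  shows "chain_cost S x z (t + s)"
  using assms
proof (induction rule: chain_cost.induct)
  case (step y z s w r)
  have "chain_cost S x w ((t + s) + r)"
    by (rule chain_cost.step[OF step.IH[OF step.prems] step.hyps(2)])
  then show ?case by (simp add: add.assoc)
qed simp

lemma chain_cost_sym:
  assumes sym: "\<And>x y s. S x y s \<Longrightarrow> S y x s" and "chain_cost S x y t"
  shows "chain_cost S y x t"
  using assms(2)
proof (induction rule: chain_cost.induct)
  case (step x y t z s)
  have "chain_cost S z x (s + t)"
    by (rule chain_cost_trans[OF step.IH chain_cost_single[of S, OF sym[OF step.hyps(2)]]])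
  then show ?case by (simp add: add.commute)
qed (rule chain_cost.refl)

lemma chain_cost_nonneg:
  assumes nn: "\<And>x y s. S x y s \<Longrightarrow> 0 \<le> s" and "chain_cost S x y t"
  shows "0 \<le> t"
  using assms(2)
proof (induction rule: chain_cost.induct)
  case (step x y t z s)
  then show ?case using nn[OF step.hyps(2)] by simp
qed simp

lemma chain_cost_map:
  assumes "\<And>x y s. S x y s \<Longrightarrow> S (g x) (g y) s" and "chain_cost S x y t"
  shows "chain_cost S (g x) (g y) t"
  using assms(2)
  by (induction rule: chain_cost.induct) (auto intro: chain_cost.intros assms(1))

text \<open>Picks out a step at which the accumulated cost passes from below \<open>a\<close> to at
  least \<open>a\<close>; the remaining cost is then at most \<open>t - a\<close>. The assumption
  \<open>0 < a\<close> excludes the empty chain.\<close>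

lemma chain_cost_split:
  assumes "chain_cost S x y t" "0 < a" "a \<le> t"
  shows "\<exists>u v t' s t''. chain_cost S x u t' \<and> t' < a \<and> S u v s \<and> chain_cost S v y t'' \<and>
    t = t' + s + t'' \<and> a \<le> t' + s"
  using assms
proof (induction rule: chain_cost.induct)
  case (refl x)
  then show ?case by simp
next
  case (step x y t z s)
  show ?case
  proof (cases "t < a")
    case True
    have "chain_cost S z z 0" by (rule chain_cost.refl)
    moreover have "t + s = t + s + 0" by simp
    ultimately show ?thesis using True step.hyps step.prems by blast
  next
    case False
    then have "a \<le> t" by simp
    from step.IH[OF step.prems(1) this] obtain u v t' s' t'' where
      *: "chain_cost S x u t'" "t' < a" "S u v s'" "chain_cost S v y t''" "t = t' + s' + t''" "a \<le> t' + s'"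
      by blast
    have "chain_cost S v z (t'' + s)" by (rule chain_cost.step[OF *(4) step.hyps(2)])
    moreover have "t + s = t' + s' + (t'' + s)" using *(5) by simp
    ultimately show ?thesis using * by blast
  qed
qed

lemma compactly_bounded_translates:
  assumes np: "nearly_proper X G" and ac: "acts_on (topspace X) G" and K: "compactin X K"
  shows "compactly_bounded X {(x, y). \<exists>g\<in>G. \<exists>a\<in>K. \<exists>b\<in>K. x = g a \<and> y = g b}"
    (is "compactly_bounded X ?E")
  unfolding compactly_bounded_def
proof (intro allI impI)
  fix A assume A: "compactin X A"
  let ?W = "\<Union>{g ` K |g. g \<in> G \<and> g ` K \<inter> A \<noteq> {}}"
  have KX: "K \<subseteq> topspace X" by (rule compactin_subset_topspace[OF K])
  have "compactin X (X closure_of ?W)"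
    using np K A by (simp add: nearly_proper_def)
  moreover have "?W \<subseteq> topspace X"
  proof
    fix y assume "y \<in> ?W"
    then obtain g k where "g \<in> G" "k \<in> K" "y = g k" by blast
    then show "y \<in> topspace X" using acts_on_closed[OF ac] KX by blast
  qed
  then have "?W \<subseteq> X closure_of ?W" by (rule closure_of_subset)
  moreover have "?E `` A \<subseteq> ?W" by blast
  ultimately show "\<exists>B. compactin X B \<and> ?E `` A \<subseteq> B" by blast
qed

text \<open>
  A chain of total cost below 1 uses small steps only, so \<open>\<rho>\<close> agrees with \<open>J\<close> at small scales.
  A chain of total cost below \<open>(k+1)/2\<close> is a chain of cost below \<open>k/2\<close>, one further step, and
  small steps adding up to less than \<open>1/2\<close>; hence balls are relatively compact, by induction.
\<close>

lemma proper_invariant_metric: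
  assumes J: "invariant_metric X G J"
    and cb: "compactly_bounded X {(x, y). x \<in> topspace X \<and> y \<in> topspace X \<and> J x y < 1}"
    and ac: "acts_on (topspace X) G" and np: "nearly_proper X G" and sc: "sigma_compact_space X"
  obtains \<rho> where "invariant_metric X G \<rho>"
    "\<And>x \<epsilon>. x \<in> topspace X \<Longrightarrow> \<exists>B. compactin X B \<and> {y \<in> topspace X. \<rho> x y < \<epsilon>} \<subseteq> B"
proof -
  let ?M = "topspace X"
  have Jc: "compatible_metric X J" using J by (simp add: invariant_metric_def)
  then interpret Metric_space ?M J by (simp add: compatible_metric_def)
  obtain C :: "nat \<Rightarrow> 'a set" where C: "\<And>n. compactin X (C n)" "(\<Union>n. C n) = ?M"
    using sigma_compact_space_sequence[OF sc] by blast
  \<comment> \<open>Partial unions put any two points into a common \<open>K n\<close>, so every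
    pair is joined by a single step of finite cost; they also make \<open>E n\<close> increase with
    \<open>n\<close>.\<close>
  define K where "K n = (\<Union>i\<le>n. C i)" for n
  have K: "compactin X (K n)" for n unfolding K_def using C(1) by (intro compactin_Union) auto
  have K_mono: "K m \<subseteq> K n" if "m \<le> n" for m n
    unfolding K_def using that by (intro UN_mono) auto
  have K_sub: "K n \<subseteq> ?M" for n by (rule compactin_subset_topspace[OF K])
  define E where "E n = {(x, y). \<exists>g\<in>G. \<exists>a\<in>K n. \<exists>b\<in>K n. x = g a \<and> y = g b}" for n
  have E_sub: "x \<in> ?M \<and> y \<in> ?M" if "(x, y) \<in> E n" for x y n
    using that K_sub[of n] acts_on_closed[OF ac] unfolding E_def by blast
  have E_mono: "E m \<subseteq> E n" if "m \<le> n" for m n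
    using K_mono[OF that] unfolding E_def by blast
  have E_cb: "compactly_bounded X (E n)" for n
    unfolding E_def by (rule compactly_bounded_translates[OF np ac K])
  have E_inv: "(g x, g y) \<in> E n" if g: "g \<in> G" and xy: "(x, y) \<in> E n" for g x y n
  proof -
    obtain h a b where h: "h \<in> G" "a \<in> K n" "b \<in> K n" "x = h a" "y = h b"
      using xy unfolding E_def by blast
    obtain k where "k \<in> G" "\<forall>x\<in>?M. k x = g (h x)" using acts_on_mult[OF ac g h(1)] by blast
    then have "k \<in> G" "g x = k a" "g y = k b" using h K_sub[of n] by auto
    then show ?thesis using h(2,3) unfolding E_def by blast
  qed
  have E_cover: "\<exists>n. (x, y) \<in> E n" if xy: "x \<in> ?M" "y \<in> ?M" for x y
  proof -
    obtain i j where ij: "x \<in> C i" "y \<in> C j" using xy unfolding C(2)[symmetric] by blast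
    then have "x \<in> K (max i j)" "y \<in> K (max i j)" unfolding K_def by auto
    moreover obtain e where "e \<in> G" "\<forall>x\<in>?M. e x = x" using acts_on_one[OF ac] by blast
    then have "e \<in> G" "x = e x" "y = e y" using xy by auto
    ultimately have "(x, y) \<in> E (max i j)" unfolding E_def by blast
    then show ?thesis by blast
  qed
  define R where "R = {(x, y). x \<in> ?M \<and> y \<in> ?M \<and> J x y < 1}"
  \<comment> \<open>The summand 1 makes even an \<open>E 0\<close> step too expensive to affect
    small distances. The growth with \<open>n\<close> means that a bound on the cost also bounds the
    index.\<close>
  define S where "S x y s \<longleftrightarrow> (x, y) \<in> R \<and> s = J x y \<or> (\<exists>n. (x, y) \<in> E n \<and> s = 1 + real n)" for x y s
  have S_nn: "0 \<le> s" if "S x y s" for x y s using that by (auto simp: S_def)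
  have S_sym: "S y x s" if "S x y s" for x y s
    using that commute[of x y] by (auto simp: S_def R_def E_def)
  have S_M: "x \<in> ?M \<and> y \<in> ?M" if "S x y s" for x y s
    using that E_sub by (auto simp: S_def R_def)
  have S_inv: "S (g x) (g y) s" if g: "g \<in> G" and s: "S x y s" for g x y s
    using s J g E_inv[OF g] acts_on_closed[OF ac g]
    by (auto simp: S_def R_def invariant_metric_def)
  have nn: "0 \<le> t" if "chain_cost S x y t" for x y t
    using S_nn that by (rule chain_cost_nonneg)
  have in_M: "y \<in> ?M" if "chain_cost S x y t" "x \<in> ?M" for x y t
    using that by (induction rule: chain_cost.induct) (auto dest: S_M)
  \<comment> \<open>The triangle inequality for \<open>J\<close> merges any number of small steps
    into one, so a cheap chain is controlled without counting its steps.\<close>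
  have small: "J x y \<le> t" if "chain_cost S x y t" "x \<in> ?M" "t < 1" for x y t
    using that
  proof (induction rule: chain_cost.induct)
    case (step x y t z s)
    have st: "0 \<le> t" "0 \<le> s" using nn[OF step.hyps(1)] S_nn[OF step.hyps(2)] by auto
    have "s = J y z" using step.hyps(2) step.prems st unfolding S_def by auto
    moreover have "J x y \<le> t" using step.IH step.prems st by simp
    moreover have "J x z \<le> J x y + J y z"
      using S_M[OF step.hyps(2)] step.prems by (intro triangle) auto
    ultimately show ?case by simp
  qed simp
  define \<rho>\<^sub>0 where "\<rho>\<^sub>0 x y = Inf {t. chain_cost S x y t}" for x y
  have bdd: "bdd_below {t. chain_cost S x y t}" for x y
    by (rule bdd_belowI[of _ 0]) (simp add: nn)
  have ne: "{t. chain_cost S x y t} \<noteq> {}" if "x \<in> ?M" "y \<in> ?M" for x y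
  proof -
    obtain n where "(x, y) \<in> E n" using E_cover[OF \<open>x \<in> ?M\<close> \<open>y \<in> ?M\<close>] by blast
    then have "S x y (1 + real n)" by (auto simp: S_def)
    from chain_cost_single[of S, OF this] show ?thesis by auto
  qed
  have le: "\<rho>\<^sub>0 x y \<le> t" if "chain_cost S x y t" for x y t
    unfolding \<rho>\<^sub>0_def using that by (intro cInf_lower bdd) simp
  have ge: "b \<le> \<rho>\<^sub>0 x y" if "x \<in> ?M" "y \<in> ?M" "\<And>t. chain_cost S x y t \<Longrightarrow> b \<le> t" for x y b
    unfolding \<rho>\<^sub>0_def using that ne by (intro cInf_greatest) auto
  have less: "\<exists>t. chain_cost S x y t \<and> t < b" if "x \<in> ?M" "y \<in> ?M" "\<rho>\<^sub>0 x y < b" for x y b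
    using cInf_less_iff[OF ne[OF that(1,2)] bdd, of b] that(3) unfolding \<rho>\<^sub>0_def by auto
  have \<rho>_le_J: "\<rho>\<^sub>0 x y \<le> J x y" if "x \<in> ?M" "y \<in> ?M" "J x y < 1" for x y
  proof -
    have "S x y (J x y)" using that by (simp add: S_def R_def)
    from le[OF chain_cost_single[of S, OF this]] show ?thesis .
  qed
  have J_le_\<rho>: "J x y \<le> \<rho>\<^sub>0 x y" if xy: "x \<in> ?M" "y \<in> ?M" and "\<rho>\<^sub>0 x y < 1" for x y
  proof (rule ccontr)
    assume "\<not> J x y \<le> \<rho>\<^sub>0 x y"
    then have "\<rho>\<^sub>0 x y < min 1 (J x y)" using \<open>\<rho>\<^sub>0 x y < 1\<close> by simp
    from less[OF xy this] obtain t where "chain_cost S x y t" "t < min 1 (J x y)" by blast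
    then show False using small[of x y t] xy by simp
  qed
  define \<rho> where "\<rho> x y = (if x \<in> ?M \<and> y \<in> ?M then \<rho>\<^sub>0 x y else 0)" for x y
  have met: "Metric_space ?M \<rho>" unfolding \<rho>_def[abs_def]
  proof (rule Metric_space_restrict)
    fix x y assume xy: "x \<in> ?M" "y \<in> ?M"
    show "0 \<le> \<rho>\<^sub>0 x y" using xy nn by (rule ge)
    have "chain_cost S x y t \<longleftrightarrow> chain_cost S y x t" for t
      using chain_cost_sym[of S, OF S_sym] by blast
    then show "\<rho>\<^sub>0 x y = \<rho>\<^sub>0 y x" by (simp add: \<rho>\<^sub>0_def)
    show "\<rho>\<^sub>0 x y = 0 \<longleftrightarrow> x = y"
    proof
      assume "\<rho>\<^sub>0 x y = 0"
      then have "J x y = 0" using J_le_\<rho>[OF xy] nonneg[of x y] by simp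
      then show "x = y" using xy by simp
    next
      assume "x = y"
      then show "\<rho>\<^sub>0 x y = 0" using le[OF chain_cost.refl] \<open>0 \<le> \<rho>\<^sub>0 x y\<close> by (simp add: antisym)
    qed
  next
    fix x y z assume xyz: "x \<in> ?M" "y \<in> ?M" "z \<in> ?M"
    have "\<rho>\<^sub>0 x z - \<rho>\<^sub>0 x y \<le> \<rho>\<^sub>0 y z"
    proof (rule ge[OF xyz(2,3)])
      fix s assume s: "chain_cost S y z s"
      have "\<rho>\<^sub>0 x z - s \<le> \<rho>\<^sub>0 x y"
      proof (rule ge[OF xyz(1,2)])
        fix t assume "chain_cost S x y t"
        from le[OF chain_cost_trans[OF s this]] show "\<rho>\<^sub>0 x z - s \<le> t" by simp
      qed
      then show "\<rho>\<^sub>0 x z - \<rho>\<^sub>0 x y \<le> s" by simp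
    qed
    then show "\<rho>\<^sub>0 x z \<le> \<rho>\<^sub>0 x y + \<rho>\<^sub>0 y z" by simp
  qed
  have "compatible_metric X \<rho>"
  proof (rule compatible_metric_transfer[OF Jc met])
    fix x and \<epsilon> :: real assume x: "x \<in> ?M" and e: "\<epsilon> > 0"
    show "\<exists>\<delta>>0. \<forall>y\<in>?M. J x y < \<delta> \<longrightarrow> \<rho> x y < \<epsilon>"
      using e x \<rho>_le_J[OF x] by (intro exI[of _ "min 1 \<epsilon>"]) (auto simp: \<rho>_def intro: le_less_trans)
    show "\<exists>\<delta>>0. \<forall>y\<in>?M. \<rho> x y < \<delta> \<longrightarrow> J x y < \<epsilon>"
      using e x J_le_\<rho>[OF x] by (intro exI[of _ "min 1 \<epsilon>"]) (auto simp: \<rho>_def intro: le_less_trans)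
  qed
  moreover have "\<rho> (g x) (g y) = \<rho> x y" if g: "g \<in> G" and xy: "x \<in> ?M" "y \<in> ?M" for g x y
  proof -
    obtain k where k: "k \<in> G" "\<forall>x\<in>?M. k (g x) = x \<and> g (k x) = x"
      using acts_on_inverse[OF ac g] by blast
    have "chain_cost S (g x) (g y) t \<longleftrightarrow> chain_cost S x y t" for t
    proof
      assume "chain_cost S (g x) (g y) t"
      from chain_cost_map[of S k, OF S_inv[OF k(1)] this] show "chain_cost S x y t" using k(2) xy by simp
    qed (rule chain_cost_map[of S g, OF S_inv[OF g]])
    then show ?thesis using acts_on_closed[OF ac g] xy by (simp add: \<rho>_def \<rho>\<^sub>0_def)
  qed
  moreover have "\<exists>B. compactin X B \<and> {y \<in> ?M. \<rho> x y < \<epsilon>} \<subseteq> B" if x: "x \<in> ?M" for x \<epsilon>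
  proof -
    have R: "compactly_bounded X R" unfolding R_def by (rule cb)
    have near: "(x, y) \<in> R" if "chain_cost S x y t" "x \<in> ?M" "t < 1" for x y t
      using small[OF that] in_M[OF that(1,2)] that(2,3) by (simp add: R_def)
    have balls: "\<exists>Q. compactly_bounded X Q \<and>
        (\<forall>x y t. x \<in> ?M \<longrightarrow> chain_cost S x y t \<longrightarrow> t < (real k + 1) / 2 \<longrightarrow> (x, y) \<in> Q)" for k
    proof (induction k)
      case 0
      show ?case using R near by (intro exI[of _ R]) auto
    next
      case (Suc k)
      then obtain Q where Q: "compactly_bounded X Q"
        "\<And>x y t. x \<in> ?M \<Longrightarrow> chain_cost S x y t \<Longrightarrow> t < (real k + 1) / 2 \<Longrightarrow> (x, y) \<in> Q" by blast
      \<comment> \<open>The factors are the cheaper initial chain, the splitting step and the merged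
        tail. A splitting step of index \<open>n\<close> costs \<open>1 + n < k + 2\<close>, so
        \<open>n \<le> k\<close> and \<open>E k\<close> contains it.\<close>
      let ?Q = "Q \<union> Q O (R \<union> E k) O R"
      have "compactly_bounded X ?Q"
        using Q(1) R E_cb by (intro compactly_bounded_Un compactly_bounded_relcomp)
      moreover have "(x, y) \<in> ?Q"
        if x: "x \<in> ?M" and xy: "chain_cost S x y t" and t: "t < (real (Suc k) + 1) / 2" for x y t
      proof (cases "t < (real k + 1) / 2")
        case False
        then obtain u v t' s t'' where *: "chain_cost S x u t'" "t' < (real k + 1) / 2" "S u v s"
          "chain_cost S v y t''" "t = t' + s + t''" "(real k + 1) / 2 \<le> t' + s"
          using chain_cost_split[OF xy, of "(real k + 1) / 2"] by auto
        have uv: "u \<in> ?M" "v \<in> ?M" using S_M[OF *(3)] by auto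
        have 1: "(x, u) \<in> Q" using Q(2)[OF x *(1,2)] .
        have "t'' < 1" using *(5,6) t by simp
        then have 2: "(v, y) \<in> R" using near[OF *(4) uv(2)] by blast
        have "s < real k + 2" using *(5) t nn[OF *(1)] nn[OF *(4)] by simp
        have "(u, v) \<in> R \<union> E k"
          using *(3) unfolding S_def
        proof (elim disjE exE conjE)
          fix n assume n: "(u, v) \<in> E n" "s = 1 + real n"
          then have "n \<le> k" using \<open>s < real k + 2\<close> by simp
          then show ?thesis using E_mono n(1) by blast
        qed simp
        then show ?thesis using 1 2 by blast
      qed (use Q(2)[OF x xy] in blast)
      ultimately show ?case by blast
    qed
    obtain k :: nat where k: "2 * \<epsilon> < real k" using reals_Archimedean2 by blast
    obtain Q where Q: "compactly_bounded X Q"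
      "\<And>x y t. x \<in> ?M \<Longrightarrow> chain_cost S x y t \<Longrightarrow> t < (real k + 1) / 2 \<Longrightarrow> (x, y) \<in> Q"
      using balls[of k] by blast
    have "compactin X {x}" using x by simp
    then obtain B where B: "compactin X B" "Q `` {x} \<subseteq> B"
      using Q(1) unfolding compactly_bounded_def by blast
    have "y \<in> B" if y: "y \<in> ?M" "\<rho> x y < \<epsilon>" for y
    proof -
      have "\<rho>\<^sub>0 x y < \<epsilon>" using x y by (simp add: \<rho>_def)
      from less[OF x y(1) this] obtain t where t: "chain_cost S x y t" "t < \<epsilon>" by blast
      then have "(x, y) \<in> Q" using Q(2)[OF x t(1)] k by simp
      then show ?thesis using B(2) by blast
    qed
    then show ?thesis using B(1) by blast
  qed
  ultimately show ?thesis by (intro that[of \<rho>]) (auto simp: invariant_metric_def)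
qed

theorem mainTheorem4:
  fixes X :: "'a topology" and G :: "('a \<Rightarrow> 'a) set"
  assumes "locally_compact_space X"
    and "sigma_compact_space X"
    and "metrizable_space X"
    and "homeomorphism_group X G"
    and "regular_space (orbit_space X G)"
    and "equiregular X G"
    and "nearly_proper X G"
  shows "singly_properly_isometrizable X G"
proof -
  have ac: "acts_on (topspace X) G" by (rule homeomorphism_group_acts_on) fact
  obtain D where D: "compatible_metric X D"
    "\<And>x y. x \<in> topspace X \<Longrightarrow> y \<in> topspace X \<Longrightarrow> D x y \<le> 2"
    "\<And>\<epsilon>. \<epsilon> > 0 \<Longrightarrow> \<exists>L. compactin X L \<and> (\<forall>x\<in>topspace X - L. \<forall>y\<in>topspace X - L. D x y < \<epsilon>)"
    using metric_vanishing_at_infinity[OF assms(1-3)] by blast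
  obtain d where d: "invariant_metric X G d"
    using invariant_metric_exists[OF assms(6) ac D] by blast
  obtain J where J: "invariant_metric X G J"
    "compactly_bounded X {(x, y). x \<in> topspace X \<and> y \<in> topspace X \<and> J x y < 1}"
    using invariant_metric_compactly_bounded[OF d assms(4,1)] by blast
  obtain \<rho> where \<rho>: "invariant_metric X G \<rho>"
    "\<And>x \<epsilon>. x \<in> topspace X \<Longrightarrow> \<exists>B. compactin X B \<and> {y \<in> topspace X. \<rho> x y < \<epsilon>} \<subseteq> B"
    using proper_invariant_metric[OF J ac assms(7,2)] by blast
  have Hausdorff: "Hausdorff_space X" by (rule metrizable_imp_Hausdorff_space) fact
  have "compactin X (X closure_of {y \<in> topspace X. \<rho> x y < \<epsilon>})" if x: "x \<in> topspace X" for x \<epsilon>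
  proof -
    obtain B where B: "compactin X B" "{y \<in> topspace X. \<rho> x y < \<epsilon>} \<subseteq> B" using \<rho>(2)[OF x] by blast
    have "X closure_of {y \<in> topspace X. \<rho> x y < \<epsilon>} \<subseteq> B"
      by (rule closure_of_minimal[OF B(2) compactin_imp_closedin[OF Hausdorff B(1)]])
    then show ?thesis using closed_compactin[OF B(1) _ closedin_closure_of] by blast
  qed
  with \<rho>(1) show ?thesis
    unfolding singly_properly_isometrizable_def invariant_metric_def compatible_metric_def by blast
qed

end
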